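(* Consider a constrained mechanical system with generalized coordinates $q\in\mathbb{R}^n$, $$M(q)\ddot q+C(q,\dot q)\dot q=f_g+f_c+f,\qquad A(q)\dot q=0,$$ where $M(q)$ is symmetric positive-definite, $\dot M-2C$ is skew-symmetric, and $A(q)\in\mathbb{R}^{m\times n}$ may or may not have full rank. Let $P$ be the orthogonal projection onto the null space $\mathcal N(A)$, $Q=I-P$, $\Lambda=-A^+\dot A$, let $\mu$ be any positive scalar, and define the constraint inertia matrix $\bar M$ and the matrix $\bar C$ by $$\bar M(q)=PM(q)P+\mu Q,\qquad \bar C(q,\dot q)=PC(q,\dot q)P+PM(\Lambda P+P\Lambda^T)-\mu\Lambda P.$$ Then: 1. The constraint inertia matrix $\bar M$ is always symmetric positive-definite, even if $A(q)$ becomes singular. 2. The matrix $\frac{d}{dt}\bar M-2\bar C$ is skew-symmetric.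
   Context: $M(q)\in\mathbb{R}^{n\times n}$ is the inertia matrix, $C(q,\dot q)\in\mathbb{R}^{n\times n}$ contains the Coriolis and centrifugal terms, $A(q)\in\mathbb{R}^{m\times n}$ is the constraint matrix, whose rank $r\le m$ may depend on $q$ (it can be rank-deficient, i.e. singular, at some configurations), $f_g$ is the gravitational generalized force, $f_c\in\mathcal N(A)^\perp$ the generalized constraint force and $f$ the generalized input force, all in $\mathbb{R}^n$. $P\in\mathbb{R}^{n\times n}$ satisfies $\mathcal R(P)=\mathcal N(A)$ (where $\mathcal R$ denotes range), $P^2=P$, $P^T=P$, i.e. $P=I-A^+A$, with $A^+$ the Moore–Penrose pseudo-inverse of $A$. Dots and $\frac{d}{dt}$ denote time derivatives along the motion $q(t)$.
   Formalization: Part 2 is asserted at the instants where the projection P(q(t)) is differentiable in time; where the rank of A jumps, P is discontinuous, the derivative of the constraint inertia matrix need not exist, and the claim can fail. *)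

theory Defs
  imports "HOL-Analysis.Analysis"
begin

definition symmetric_matrix :: "real^'n^'n \<Rightarrow> bool" where
  "symmetric_matrix B \<longleftrightarrow> transpose B = B"

definition skew_symmetric_matrix :: "real^'n^'n \<Rightarrow> bool" where
  "skew_symmetric_matrix B \<longleftrightarrow> transpose B = - B"

definition sym_pos_def :: "real^'n^'n \<Rightarrow> bool" where
  "sym_pos_def B \<longleftrightarrow> symmetric_matrix B \<and> (\<forall>x. x \<noteq> 0 \<longrightarrow> x \<bullet> (B *v x) > 0)"

definition null_space :: "real^'n^'m \<Rightarrow> (real^'n) set" where
  "null_space B = {x. B *v x = 0}"

definition is_orth_projection :: "(real^'n) set \<Rightarrow> real^'n^'n \<Rightarrow> bool" where
  "is_orth_projection S P \<longleftrightarrow>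
     range (\<lambda>x. P *v x) = S \<and> P ** P = P \<and> transpose P = P"

definition orth_projection :: "(real^'n) set \<Rightarrow> real^'n^'n" where
  "orth_projection S = (THE P. is_orth_projection S P)"

definition is_pinv :: "real^'n^'m \<Rightarrow> real^'m^'n \<Rightarrow> bool" where
  "is_pinv B X \<longleftrightarrow> B ** X ** B = B \<and> X ** B ** X = X \<and>
     transpose (B ** X) = B ** X \<and> transpose (X ** B) = X ** B"

definition pinv :: "real^'n^'m \<Rightarrow> real^'m^'n" where
  "pinv B = (THE X. is_pinv B X)"

text \<open>Both definite descriptions denote: the projection and the Moore--Penrose
  pseudo-inverse exist and are unique, whatever the rank of the matrix.\<close>

lemma is_orth_projection_unique:
  fixes S :: "(real^'n) set"
  assumes "is_orth_projection S P" "is_orth_projection S P'"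
  shows "P = P'"
proof -
  have fix_range: "R *v x = x" if "is_orth_projection S R" "x \<in> S" for R :: "real^'n^'n" and x
  proof -
    have "x \<in> range (\<lambda>x. R *v x)"
      using that unfolding is_orth_projection_def by simp
    then obtain y where "x = R *v y" by blast
    then show ?thesis
      using that unfolding is_orth_projection_def by (simp add: matrix_vector_mul_assoc)
  qed
  have mult: "R ** R' = R'" if "is_orth_projection S R" "is_orth_projection S R'"
    for R R' :: "real^'n^'n"
  proof -
    have "R *v (R' *v x) = R' *v x" for x
      using fix_range[OF that(1)] that(2) unfolding is_orth_projection_def by blast
    then show ?thesis
      by (simp add: matrix_eq matrix_vector_mul_assoc)
  qed
  have "P' = transpose (P ** P')"
    using mult[OF assms] assms(2) by (simp add: is_orth_projection_def)
  also have "\<dots> = P' ** P"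
    using assms by (simp add: matrix_transpose_mul is_orth_projection_def)
  also have "\<dots> = P"
    using mult[OF assms(2) assms(1)] .
  finally show ?thesis by simp
qed

lemma is_orth_projection_exists:
  fixes S :: "(real^'n) set"
  assumes "subspace S"
  shows "\<exists>P. is_orth_projection S P"
proof -
  obtain B where B: "B \<subseteq> S" "pairwise orthogonal B" "\<And>x. x \<in> B \<Longrightarrow> norm x = 1"
      "independent B" "span B = S"
    using orthonormal_basis_subspace[OF assms] by metis
  have fin: "finite B" using B(4) by (rule independent_imp_finite)
  define f where "f = (\<lambda>x. \<Sum>b\<in>B. (b \<bullet> x) *\<^sub>R b)"
  have lin: "linear f"
    unfolding f_def by (intro linear_compose_sum ballI linearI)
      (auto simp: inner_add_right scaleR_add_left)
  have inS: "f x \<in> S" for x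
    unfolding f_def using B(1) assms by (intro subspace_sum subspace_scale) auto
  have f_basis: "f b = b" if "b \<in> B" for b
  proof -
    have "f b = (\<Sum>c\<in>B. if c = b then b else 0)"
      unfolding f_def using B(2,3) that
      by (intro sum.cong) (auto simp: pairwise_def orthogonal_def dot_square_norm)
    then show ?thesis using fin that by simp
  qed
  have f_id: "f x = x" if "x \<in> S" for x
    using linear_eq_on[OF lin linear_id, of x B] f_basis that B(5) by simp
  have sym: "f x \<bullet> y = x \<bullet> f y" for x y
    by (simp add: f_def inner_sum_left inner_sum_right inner_commute mult.commute)
  have mf: "matrix f *v x = f x" for x
    using lin by (simp add: matrix_works)
  have "range (\<lambda>x. matrix f *v x) = S"
    unfolding mf using inS f_id by (metis image_subset_iff rangeI subsetI subset_antisym)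
  moreover have "matrix f ** matrix f = matrix f"
    using f_id inS by (simp add: matrix_eq matrix_vector_mul_assoc[symmetric] mf)
  moreover have "transpose (matrix f) = matrix f"
  proof -
    have "adjoint f = f" using sym by (intro adjoint_unique) simp
    then show ?thesis using matrix_adjoint[OF lin] by simp
  qed
  ultimately show ?thesis unfolding is_orth_projection_def by blast
qed

lemma orth_projection:
  assumes "subspace S"
  shows "is_orth_projection S (orth_projection S)"
  unfolding orth_projection_def
  using is_orth_projection_exists[OF assms] is_orth_projection_unique by (metis theI')

lemma subspace_null_space: "subspace (null_space B)"
  by (auto simp: subspace_def null_space_def matrix_vector_right_distrib
      matrix_vector_mult_scaleR)

lemma is_pinv_unique:
  assumes X: "is_pinv B X" and Y: "is_pinv B Y"
  shows "X = Y"
proof -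
  note x = X[unfolded is_pinv_def] and y = Y[unfolded is_pinv_def]
  have l: "B ** X = B ** Y"
  proof -
    have "B ** X = transpose (B ** Y ** (B ** X))"
      using x y by (simp add: matrix_mul_assoc)
    also have "\<dots> = (B ** X) ** (B ** Y)"
      using x y by (simp only: matrix_transpose_mul[of "B ** Y"])
    also have "\<dots> = B ** Y" using x by (simp add: matrix_mul_assoc)
    finally show ?thesis .
  qed
  have r: "X ** B = Y ** B"
  proof -
    have "X ** B = transpose ((X ** B) ** (Y ** B))"
      using x y by (metis matrix_mul_assoc)
    also have "\<dots> = (Y ** B) ** (X ** B)"
      using x y by (simp only: matrix_transpose_mul[of "X ** B"])
    also have "\<dots> = Y ** B" using x by (metis matrix_mul_assoc)
    finally show ?thesis .
  qed
  have "X = X ** B ** X" using x by simp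
  also have "\<dots> = Y ** (B ** X)" using r by (simp add: matrix_mul_assoc)
  also have "\<dots> = Y" using l y by (simp add: matrix_mul_assoc)
  finally show ?thesis .
qed

lemma is_pinv_exists: "\<exists>X. is_pinv B X \<and> X ** B = mat 1 - orth_projection (null_space B)"
proof -
  define P where "P = orth_projection (null_space B)"
  define Q where "Q = mat 1 - P"
  define R where "R = orth_projection (range (\<lambda>x. B *v x))"
  have P: "range (\<lambda>x. P *v x) = null_space B" "P ** P = P" "transpose P = P"
    using orth_projection[OF subspace_null_space]
    unfolding P_def is_orth_projection_def by auto
  have "subspace (range (\<lambda>x. B *v x))"
    by (intro linear_subspace_image matrix_vector_mul_linear subspace_UNIV)
  from orth_projection[OF this]
  have R: "range (\<lambda>x. R *v x) = range (\<lambda>x. B *v x)" "R ** R = R" "transpose R = R"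
    unfolding R_def is_orth_projection_def by auto
  have Qv: "Q *v x = x - P *v x" for x
    by (simp add: Q_def matrix_vector_mult_diff_rdistrib)
  have BP: "B *v (P *v x) = 0" for x using P(1) unfolding null_space_def by blast
  have BQ: "B *v (Q *v x) = B *v x" for x
    by (simp add: Qv matrix_vector_mult_diff_distrib BP)
  have PP: "P *v (P *v x) = P *v x" for x
    using P(2) by (simp add: matrix_vector_mul_assoc)
  have QQ: "Q *v (Q *v x) = Q *v x" for x
    by (simp add: Qv matrix_vector_mult_diff_distrib PP)
  have Pnull: "P *v x = x" if "B *v x = 0" for x
  proof -
    have "x \<in> range (\<lambda>x. P *v x)" using that P(1) by (simp add: null_space_def)
    then show ?thesis using PP by auto
  qed
  have RB: "R *v (B *v x) = B *v x" for x
  proof -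
    have "B *v x \<in> range (\<lambda>x. R *v x)" using R(1) by blast
    then obtain y where "B *v x = R *v y" by blast
    then show ?thesis using R(2) by (metis matrix_vector_mul_assoc)
  qed
  have subQ: "subspace (range (\<lambda>x. Q *v x))"
    by (intro linear_subspace_image matrix_vector_mul_linear subspace_UNIV)
  have "inj_on (\<lambda>x. B *v x) (range (\<lambda>x. Q *v x))"
  proof (rule inj_onI)
    fix x y assume xy: "x \<in> range (\<lambda>x. Q *v x)" "y \<in> range (\<lambda>x. Q *v x)" "B *v x = B *v y"
    then have "Q *v x = x" "Q *v y = y" using QQ by auto
    moreover have "P *v (x - y) = x - y"
      using xy(3) by (intro Pnull) (simp add: matrix_vector_mult_diff_distrib)
    ultimately show "x = y"
      by (simp add: Qv matrix_vector_mult_diff_distrib)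
  qed
  then obtain g where g: "linear g" "\<forall>v\<in>span (range (\<lambda>x. Q *v x)). g (B *v v) = v"
    using linear_exists_left_inverse_on[of "\<lambda>x. B *v x" "span (range (\<lambda>x. Q *v x))"] subQ
    by (metis matrix_vector_mul_linear span_eq_iff subspace_span)
  define G where "G = matrix g"
  have G: "G *v (B *v (Q *v x)) = Q *v x" for x
    using g by (simp add: G_def matrix_works span_base)
  define X where "X = Q ** (G ** R)"
  have Xv: "X *v y = Q *v (G *v (R *v y))" for y
    by (simp add: X_def matrix_vector_mul_assoc[symmetric])
  have BX: "B ** X = R"
  proof -
    have "B *v (X *v y) = R *v y" for y
    proof -
      have "R *v y \<in> range (\<lambda>x. B *v x)" using R(1) by blast
      then obtain x where x: "R *v y = B *v x" by blast
      have "B *v (X *v y) = B *v (G *v (B *v (Q *v x)))"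
        by (simp only: Xv BQ x)
      also have "\<dots> = B *v x" by (subst G) (rule BQ)
      finally show ?thesis using x by simp
    qed
    then show ?thesis by (simp add: matrix_eq matrix_vector_mul_assoc)
  qed
  have XB: "X ** B = Q"
  proof -
    have "X *v (B *v x) = Q *v x" for x
      using G[of x] by (simp only: Xv RB BQ QQ)
    then show ?thesis by (simp add: matrix_eq matrix_vector_mul_assoc)
  qed
  have "B ** X ** B = B"
    unfolding BX using RB by (simp add: matrix_eq matrix_vector_mul_assoc[symmetric])
  moreover have "X ** B ** X = X"
    unfolding XB by (simp add: matrix_eq matrix_vector_mul_assoc[symmetric] Xv QQ)
  moreover have "transpose Q = Q"
    using P(3) by (simp add: Q_def transpose_def vec_eq_iff mat_def)
  ultimately have "is_pinv B X"
    using R(3) BX XB by (simp add: is_pinv_def)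
  then show ?thesis using XB Q_def P_def by blast
qed

lemma pinv: "is_pinv B (pinv B)"
  unfolding pinv_def using is_pinv_exists is_pinv_unique by (metis theI')

lemma orth_projection_null_space: "orth_projection (null_space B) = mat 1 - pinv B ** B"
proof -
  obtain X where "is_pinv B X" "X ** B = mat 1 - orth_projection (null_space B)"
    using is_pinv_exists by blast
  then show ?thesis using is_pinv_unique[OF pinv] by (metis diff_diff_eq2 add_diff_cancel_left')
qed

abbreviation time_deriv :: "(real \<Rightarrow> 'a::real_normed_vector) \<Rightarrow> real \<Rightarrow> 'a" where
  "time_deriv f t \<equiv> vector_derivative f (at t)"

text \<open>The motion \<open>q\<close> solves the equations of motion on the open time interval \<open>T\<close>. The
  forces \<open>fc\<close> and \<open>f\<close> are given as functions of time along the motion.\<close>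

definition constrained_motion ::
  "real set \<Rightarrow> (real^'n \<Rightarrow> real^'n^'n) \<Rightarrow> (real^'n \<Rightarrow> real^'n \<Rightarrow> real^'n^'n) \<Rightarrow>
   (real^'n \<Rightarrow> real^'n^'m) \<Rightarrow> (real^'n \<Rightarrow> real^'n) \<Rightarrow> (real \<Rightarrow> real^'n) \<Rightarrow> (real \<Rightarrow> real^'n) \<Rightarrow>
   (real \<Rightarrow> real^'n) \<Rightarrow> bool" where
  "constrained_motion T M C A fg fc f q \<longleftrightarrow>
     open T \<and> is_interval T \<and>
     (\<forall>t\<in>T. q differentiable (at t) \<and> time_deriv q differentiable (at t) \<and>
        M (q t) *v time_deriv (time_deriv q) t + C (q t) (time_deriv q t) *v time_deriv q t
          = fg (q t) + fc t + f t \<and>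
        A (q t) *v time_deriv q t = 0 \<and>
        fc t \<in> (null_space (A (q t)))\<^sup>\<bottom>)"

definition constraint_inertia ::
  "real \<Rightarrow> (real^'n \<Rightarrow> real^'n^'n) \<Rightarrow> (real^'n \<Rightarrow> real^'n^'m) \<Rightarrow> real^'n \<Rightarrow> real^'n^'n" where
  "constraint_inertia \<mu> M A x =
     (let P = orth_projection (null_space (A x)); Q = mat 1 - P
      in P ** M x ** P + \<mu> *\<^sub>R Q)"

definition Lambda_matrix ::
  "(real^'n \<Rightarrow> real^'n^'m) \<Rightarrow> (real \<Rightarrow> real^'n) \<Rightarrow> real \<Rightarrow> real^'n^'n" where
  "Lambda_matrix A q t = - (pinv (A (q t)) ** time_deriv (\<lambda>s. A (q s)) t)"

definition constraint_coriolis ::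
  "real \<Rightarrow> (real^'n \<Rightarrow> real^'n^'n) \<Rightarrow> (real^'n \<Rightarrow> real^'n \<Rightarrow> real^'n^'n) \<Rightarrow>
   (real^'n \<Rightarrow> real^'n^'m) \<Rightarrow> (real \<Rightarrow> real^'n) \<Rightarrow> real \<Rightarrow> real^'n^'n" where
  "constraint_coriolis \<mu> M C A q t =
     (let P = orth_projection (null_space (A (q t))); \<Lambda> = Lambda_matrix A q t
      in P ** C (q t) (time_deriv q t) ** P
         + P ** M (q t) ** (\<Lambda> ** P + P ** transpose \<Lambda>)
         - \<mu> *\<^sub>R (\<Lambda> ** P))"

end

theory Submission
  imports Defs
begin

text \<open>Differentiating \<open>P P = P\<close> and \<open>A P = 0\<close> along the motion gives \<open>P' = \<Lambda> P + P \<Lambda>\<^sup>T\<close>,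
  because \<open>P' P = Q P' = A\<^sup>+ A P' = - A\<^sup>+ A' P = \<Lambda> P\<close> and, transposing,
  \<open>P P' = P \<Lambda>\<^sup>T\<close>. No derivative of \<open>A\<^sup>+\<close> enters, so the rank of
  \<open>A\<close> plays no role. Substituting, the derivative of the constraint inertia minus twice the
  constraint Coriolis matrix becomes
  \<open>P (M' - 2 C) P + (P' M P - P M P') + \<mu> (\<Lambda> P - P \<Lambda>\<^sup>T)\<close>, a sum of three skew matrices.\<close>

text \<open>In finite dimension bilinearity already gives boundedness. The interpretation below then
  supplies the product rule for matrix-valued functions of time.\<close>

lemma bounded_bilinear_matrix_mult:
  "bounded_bilinear ((**) :: real^'n^'m \<Rightarrow> real^'p^'n \<Rightarrow> real^'p^'m)"
  unfolding bilinear_conv_bounded_bilinear[symmetric] bilinear_def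
  by (auto intro!: linearI simp: matrix_matrix_mult_def vec_eq_iff algebra_simps
      sum.distrib sum_distrib_left)

interpretation matrix_mult: bounded_bilinear
  "(**) :: real^'n^'m \<Rightarrow> real^'p^'n \<Rightarrow> real^'p^'m"
  by (rule bounded_bilinear_matrix_mult)

lemma transpose_add: "transpose (B + B') = transpose B + transpose B'"
  for B B' :: "'a::plus^'n^'m"
  by (simp add: transpose_def vec_eq_iff)

lemma transpose_diff: "transpose (B - B') = transpose B - transpose B'"
  for B B' :: "'a::minus^'n^'m"
  by (simp add: transpose_def vec_eq_iff)

lemma inner_matrix_vector_mult_symmetric:
  fixes B :: "real^'n^'n"
  assumes "transpose B = B"
  shows "(B *v x) \<bullet> y = x \<bullet> (B *v y)"
  using assms by (metis dot_lmul_matrix transpose_matrix_vector)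

lemma skew_symmetric_matrix_add:
  "skew_symmetric_matrix B \<Longrightarrow> skew_symmetric_matrix B' \<Longrightarrow> skew_symmetric_matrix (B + B')"
  by (simp add: skew_symmetric_matrix_def transpose_add)

lemma skew_symmetric_matrix_scaleR:
  "skew_symmetric_matrix B \<Longrightarrow> skew_symmetric_matrix (c *\<^sub>R B)"
  by (simp add: skew_symmetric_matrix_def transpose_scalar)

lemma skew_symmetric_matrix_diff_transpose: "skew_symmetric_matrix (B - transpose B)"
  by (simp add: skew_symmetric_matrix_def transpose_diff)

lemma skew_symmetric_matrix_congruence:
  "skew_symmetric_matrix B \<Longrightarrow> skew_symmetric_matrix (transpose R ** B ** R)"
  by (simp add: skew_symmetric_matrix_def matrix_transpose_mul matrix_mul_assoc
      matrix_mult.minus_left matrix_mult.minus_right)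

text \<open>The quadratic form decouples along the orthogonal splitting \<open>x = u + v\<close>
  with \<open>u = P *v x\<close>: \<open>N\<close> sees only \<open>u\<close>, and \<open>c\<close>
  weights only \<open>v\<close>.\<close>

lemma sym_pos_def_projected_sum:
  fixes P N :: "real^'n^'n"
  assumes P: "P ** P = P" "transpose P = P" and N: "sym_pos_def N" and c: "c > 0"
  shows "sym_pos_def (P ** N ** P + c *\<^sub>R (mat 1 - P))"
  unfolding sym_pos_def_def
proof (intro conjI allI impI)
  show "symmetric_matrix (P ** N ** P + c *\<^sub>R (mat 1 - P))"
    using P N by (simp add: sym_pos_def_def symmetric_matrix_def transpose_add transpose_diff
        transpose_scalar matrix_transpose_mul matrix_mul_assoc transpose_mat)
next
  fix x :: "real^'n" assume x: "x \<noteq> 0"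
  define u v where "u = P *v x" and "v = x - P *v x"
  have Pv: "P *v v = 0"
    by (simp add: v_def matrix_vector_mult_diff_distrib matrix_vector_mul_assoc P)
  \<comment> \<open>Symmetry moves \<open>P\<close> across the inner product, onto \<open>v\<close>,
    which it annihilates.\<close>
  have "u \<bullet> v = 0"
    unfolding u_def using Pv by (simp add: inner_matrix_vector_mult_symmetric P(2))
  then have "x \<bullet> v = v \<bullet> v"
    by (simp add: v_def u_def inner_diff_left)
  moreover have "x \<bullet> (P *v (N *v u)) = u \<bullet> (N *v u)"
    unfolding u_def by (simp add: inner_matrix_vector_mult_symmetric P(2))
  ultimately have eq: "x \<bullet> ((P ** N ** P + c *\<^sub>R (mat 1 - P)) *v x) = u \<bullet> (N *v u) + c * (v \<bullet> v)"
    by (simp add: matrix_vector_mult_add_rdistrib matrix_vector_mult_diff_rdistrib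
        scaleR_matrix_vector_assoc[symmetric] matrix_vector_mul_assoc[symmetric]
        inner_add_right u_def v_def)
  have N_pos: "y \<noteq> 0 \<Longrightarrow> y \<bullet> (N *v y) > 0" for y
    using N by (simp add: sym_pos_def_def)
  \<comment> \<open>The two parts cannot both vanish: if \<open>u = 0\<close> then
    \<open>v = x\<close>, and the \<open>c\<close> term is positive; otherwise the \<open>N\<close>
    term is positive and the other nonnegative.\<close>
  show "x \<bullet> ((P ** N ** P + c *\<^sub>R (mat 1 - P)) *v x) > 0"
  proof (cases "u = 0")
    case True
    then have "v \<noteq> 0" using x by (simp add: u_def v_def)
    then show ?thesis unfolding eq using True c by simp
  next
    case False
    then show ?thesis unfolding eq using N_pos c by (intro add_pos_nonneg) simp_all
  qed
qed

lemma orth_projection_null_space_props: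
  fixes B :: "real^'n^'m"
  defines "P \<equiv> orth_projection (null_space B)"
  shows "P ** P = P" "transpose P = P" "B ** P = 0"
proof -
  have P: "is_orth_projection (null_space B) P"
    unfolding P_def by (intro orth_projection subspace_null_space)
  then show "P ** P = P" "transpose P = P"
    by (simp_all add: is_orth_projection_def)
  have "B *v (P *v x) = 0" for x
    using P by (auto simp: is_orth_projection_def null_space_def)
  then show "B ** P = 0"
    by (simp add: matrix_eq matrix_vector_mul_assoc)
qed

lemma sym_pos_def_constraint_inertia:
  assumes "sym_pos_def (M x)" "\<mu> > 0"
  shows "sym_pos_def (constraint_inertia \<mu> M A x)"
  unfolding constraint_inertia_def Let_def
  using assms by (intro sym_pos_def_projected_sum orth_projection_null_space_props)

lemma deriv_orth_projection_null_space:
  fixes A :: "real \<Rightarrow> real^'n^'m"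
  defines "P \<equiv> \<lambda>s. orth_projection (null_space (A s))"
  assumes A': "(A has_vector_derivative A') (at t)"
    and P': "(P has_vector_derivative P') (at t)"
  defines "L \<equiv> - (pinv (A t) ** A')"
  shows "P' = L ** P t + P t ** transpose L"
proof -
  have P: "P s ** P s = P s" "transpose (P s) = P s" "A s ** P s = 0" for s
    by (simp_all add: P_def orth_projection_null_space_props)
  \<comment> \<open>The product rule for \<open>P s ** P s\<close>, folded back by idempotence;
    uniqueness of derivatives then gives an equation for \<open>P'\<close>.\<close>
  have "(P has_vector_derivative P t ** P' + P' ** P t) (at t)"
    using matrix_mult.has_vector_derivative[OF P' P'] by (simp only: P)
  with P' have split: "P' = P t ** P' + P' ** P t"
    by (rule vector_derivative_unique_at)
  have "((\<lambda>s. A s ** P s) has_vector_derivative A t ** P' + A' ** P t) (at t)"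
    by (rule matrix_mult.has_vector_derivative[OF A' P'])
  \<comment> \<open>The product \<open>A s ** P s\<close> is constantly zero in
    \<open>s\<close>.\<close>
  then have "A t ** P' + A' ** P t = 0"
    using vector_derivative_unique_at[OF _ has_vector_derivative_const] by (simp add: P)
  \<comment> \<open>The pseudo-inverse enters only as a fixed matrix at time \<open>t\<close>; it
    turns \<open>A t\<close> into the complementary projection.\<close>
  then have "pinv (A t) ** (A t ** P' + A' ** P t) = 0"
    by (simp add: matrix_mult.zero_right)
  then have QP': "pinv (A t) ** A t ** P' = L ** P t"
    by (simp add: L_def matrix_mult.add_right matrix_mult.minus_left matrix_mul_assoc
        eq_neg_iff_add_eq_0)
  have "pinv (A t) ** A t = mat 1 - P t"
    by (simp add: P_def orth_projection_null_space)
  then have "pinv (A t) ** A t ** P' = P' - P t ** P'"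
    by (simp add: matrix_mult.diff_left)
  also have "\<dots> = P' ** P t"
    using split by (metis add_diff_cancel_left')
  finally have P'P: "P' ** P t = L ** P t"
    using QP' by simp
  \<comment> \<open>Transposition is linear, so it commutes with differentiation, and
    \<open>P'\<close> inherits the symmetry of \<open>P\<close>.\<close>
  have "((\<lambda>s. transpose (P s)) has_vector_derivative transpose P') (at t)"
    by (rule bounded_linear.has_vector_derivative[OF _ P'])
      (auto intro!: linear_conv_bounded_linear[THEN iffD1] linearI
        simp: transpose_add transpose_scalar)
  then have "(P has_vector_derivative transpose P') (at t)"
    by (simp only: P)
  then have "transpose P' = P'"
    using P' by (rule vector_derivative_unique_at)
  then have "P t ** P' = transpose (P' ** P t)"
    by (simp add: matrix_transpose_mul P)
  also have "\<dots> = P t ** transpose L"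
    by (simp add: P'P matrix_transpose_mul P)
  finally show ?thesis using split P'P by (metis add.commute)
qed

lemma has_vector_derivative_constraint_inertia:
  fixes q :: "real \<Rightarrow> real^'n"
    and A :: "real^'n \<Rightarrow> real^'n^'m"
  defines "P \<equiv> \<lambda>s. orth_projection (null_space (A (q s)))"
  assumes M': "((\<lambda>s. M (q s)) has_vector_derivative M') (at t)"
    and P': "(P has_vector_derivative P') (at t)"
  shows "((\<lambda>s. constraint_inertia \<mu> M A (q s)) has_vector_derivative
    P' ** M (q t) ** P t + P t ** M' ** P t + P t ** M (q t) ** P' - \<mu> *\<^sub>R P') (at t)"
proof -
  \<comment> \<open>The \<open>0\<close> is the derivative of the constant \<open>mat 1\<close>, so
    the complementary projection contributes \<open>- P'\<close>.\<close>
  have "((\<lambda>s. P s ** M (q s) ** P s + \<mu> *\<^sub>R (mat 1 - P s)) has_vector_derivative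
    (P t ** M (q t) ** P' + (P t ** M' + P' ** M (q t)) ** P t) + \<mu> *\<^sub>R (0 - P')) (at t)"
    by (intro has_vector_derivative_add matrix_mult.has_vector_derivative M' P'
        bounded_linear.has_vector_derivative[OF bounded_linear_scaleR_right]
        has_vector_derivative_diff has_vector_derivative_const)
  then show ?thesis
    by (simp add: constraint_inertia_def Let_def P_def matrix_mult.add_left algebra_simps)
qed

text \<open>Pure matrix algebra at one instant, with \<open>N\<close>, \<open>N'\<close>,
  \<open>K\<close> standing for inertia, its derivative and Coriolis matrix. Subtracting
  \<open>2 *\<^sub>R (P ** N ** P')\<close> flips the sign of one product-rule term, leaving a
  matrix minus its transpose.\<close>

lemma skew_symmetric_constraint_inertia_coriolis:
  fixes P N N' K L :: "real^'n^'n"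
  assumes P: "transpose P = P" and N: "transpose N = N"
    and skew: "skew_symmetric_matrix (N' - 2 *\<^sub>R K)"
    and P': "P' = L ** P + P ** transpose L"
  shows "skew_symmetric_matrix (P' ** N ** P + P ** N' ** P + P ** N ** P' - \<mu> *\<^sub>R P'
    - 2 *\<^sub>R (P ** K ** P + P ** N ** (L ** P + P ** transpose L) - \<mu> *\<^sub>R (L ** P)))"
proof -
  have P'_sym: "transpose P' = P'"
    by (simp add: P' P transpose_add matrix_transpose_mul add.commute)
  have "P' ** N ** P + P ** N' ** P + P ** N ** P' - \<mu> *\<^sub>R P'
      - 2 *\<^sub>R (P ** K ** P + P ** N ** P' - \<mu> *\<^sub>R (L ** P))
    = transpose P ** (N' - 2 *\<^sub>R K) ** P
      + (P' ** N ** P - transpose (P' ** N ** P))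
      + \<mu> *\<^sub>R (L ** P - transpose (L ** P))"
    (is "?lhs = ?rhs")
  proof -
    \<comment> \<open>Only the \<open>\<mu>\<close> term needs \<open>P'\<close> expanded: adding
      twice \<open>L ** P\<close> to \<open>- P'\<close> leaves \<open>L ** P\<close> minus its
      transpose. Next to \<open>N\<close>, symmetry of \<open>P'\<close> suffices.\<close>
    have "\<mu> *\<^sub>R P' = \<mu> *\<^sub>R (L ** P) + \<mu> *\<^sub>R (P ** transpose L)"
      by (simp add: P' scaleR_right_distrib)
    then show ?thesis
      by (simp add: P P'_sym N matrix_transpose_mul matrix_mul_assoc matrix_mult.diff_left
          matrix_mult.diff_right matrix_mult.scaleR_left matrix_mult.scaleR_right
          vec_eq_iff algebra_simps)
  qed
  moreover have "skew_symmetric_matrix ?rhs"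
    by (intro skew_symmetric_matrix_add skew_symmetric_matrix_scaleR
        skew_symmetric_matrix_congruence skew_symmetric_matrix_diff_transpose skew)
  ultimately show ?thesis by (simp only: P')
qed

text \<open>Definiteness is pointwise in the configuration. The second claim is stated where the
  projection is differentiable: its trace is \<open>n\<close> minus the rank of \<open>A\<close>, so
  it is discontinuous at any time near which that rank is not constant.\<close>

theorem theorem1:
  fixes M :: "real^'n \<Rightarrow> real^'n^'n"
    and C :: "real^'n \<Rightarrow> real^'n \<Rightarrow> real^'n^'n"
    and A :: "real^'n \<Rightarrow> real^'n^'m"
    and fg :: "real^'n \<Rightarrow> real^'n"
    and fc f q :: "real \<Rightarrow> real^'n"
    and T :: "real set"
    and \<mu> :: real
  assumes motion: "constrained_motion T M C A fg fc f q"
    and M_spd: "\<And>x. sym_pos_def (M x)"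
    and M_diff: "\<And>t. t \<in> T \<Longrightarrow> (\<lambda>s. M (q s)) differentiable (at t)"
    and A_diff: "\<And>t. t \<in> T \<Longrightarrow> (\<lambda>s. A (q s)) differentiable (at t)"
    and MC_skew: "\<And>t. t \<in> T \<Longrightarrow>
      skew_symmetric_matrix (time_deriv (\<lambda>s. M (q s)) t - 2 *\<^sub>R C (q t) (time_deriv q t))"
    and mu_pos: "\<mu> > 0"
  shows "(\<forall>x. sym_pos_def (constraint_inertia \<mu> M A x)) \<and>
    (\<forall>t\<in>T. (\<lambda>s. orth_projection (null_space (A (q s)))) differentiable (at t) \<longrightarrow>
      (\<lambda>s. constraint_inertia \<mu> M A (q s)) differentiable (at t) \<and>
      skew_symmetric_matrix
        (time_deriv (\<lambda>s. constraint_inertia \<mu> M A (q s)) t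
          - 2 *\<^sub>R constraint_coriolis \<mu> M C A q t))"
proof (intro conjI allI ballI impI)
  show "sym_pos_def (constraint_inertia \<mu> M A x)" for x
    by (intro sym_pos_def_constraint_inertia M_spd mu_pos)
next
  fix t
  define P where "P = (\<lambda>s. orth_projection (null_space (A (q s))))"
  assume t: "t \<in> T" and "(\<lambda>s. orth_projection (null_space (A (q s)))) differentiable (at t)"
  then have P': "(P has_vector_derivative time_deriv P t) (at t)"
    by (simp add: P_def vector_derivative_works)
  have M': "((\<lambda>s. M (q s)) has_vector_derivative time_deriv (\<lambda>s. M (q s)) t) (at t)"
    and A': "((\<lambda>s. A (q s)) has_vector_derivative time_deriv (\<lambda>s. A (q s)) t) (at t)"
    using M_diff[OF t] A_diff[OF t] by (simp_all add: vector_derivative_works)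
  note deriv = has_vector_derivative_constraint_inertia
    [where A = A and \<mu> = \<mu>, OF M' P'[unfolded P_def]]
  show "(\<lambda>s. constraint_inertia \<mu> M A (q s)) differentiable (at t)"
    using deriv by (rule differentiableI_vector)
  have "time_deriv P t = Lambda_matrix A q t ** P t + P t ** transpose (Lambda_matrix A q t)"
    unfolding Lambda_matrix_def P_def
    by (rule deriv_orth_projection_null_space[OF A' P'[unfolded P_def]])
  moreover have "transpose (P t) = P t"
    by (simp add: P_def orth_projection_null_space_props)
  moreover have "transpose (M (q t)) = M (q t)"
    using M_spd by (simp add: sym_pos_def_def symmetric_matrix_def)
  \<comment> \<open>With the derivative in closed form, the goal is the algebraic lemma with
    \<open>L\<close> taken as \<open>Lambda_matrix A q t\<close>.\<close>
  ultimately show "skew_symmetric_matrix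
      (time_deriv (\<lambda>s. constraint_inertia \<mu> M A (q s)) t
        - 2 *\<^sub>R constraint_coriolis \<mu> M C A q t)"
    unfolding vector_derivative_at[OF deriv] constraint_coriolis_def Let_def
    using skew_symmetric_constraint_inertia_coriolis[OF _ _ MC_skew[OF t]]
    unfolding P_def by blast
qed

end
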